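(* For every infinite, countably compact topological space $Y$, the relation $\omega^{*}\rightarrow(Y)^{1}_{2}$ fails.
   Context: $\omega$ is the countably infinite discrete space, $\beta(\omega)$ its Stone-Čech compactification, and $\omega^{*}=\beta(\omega)\setminus\omega$ with the subspace topology. For topological spaces $X,Y$, the relation $X\rightarrow(Y)^{1}_{2}$ means: whenever $X=P_0\cup P_1$, there are $i\in\{0,1\}$ and $Y'\subseteq P_i$ such that $Y'$ (with the subspace topology from $X$) is homeomorphic to $Y$. *)

theory Defs
  imports "HOL-Analysis.Analysis"
begin

text \<open>
  The Stone-Cech compactification of the discrete space of natural numbers is realised as its
  Stone space of ultrafilters, with a number \<open>n\<close> identified with the principal ultrafilter at
  \<open>n\<close>. Theorems \<open>beta_omega_Stone_Cech\<close> and \<open>beta_omega_extension_unique\<close> below show that this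
  is the Stone-Cech compactification: a compact Hausdorff space in which the discrete space
  embeds densely, such that every map into a compact Hausdorff space extends continuously and
  uniquely.
\<close>

definition ultrafilter :: "'a filter \<Rightarrow> bool" where
  "ultrafilter F \<longleftrightarrow> F \<noteq> bot \<and> (\<forall>P. eventually P F \<or> eventually (\<lambda>x. \<not> P x) F)"

definition beta_basic :: "nat set \<Rightarrow> nat filter set" where
  "beta_basic A = {F. ultrafilter F \<and> eventually (\<lambda>n. n \<in> A) F}"

definition beta_omega :: "nat filter topology" where
  "beta_omega = topology_generated_by (range beta_basic)"

definition omega_point :: "nat \<Rightarrow> nat filter" where
  "omega_point n = principal {n}"

definition omega_star :: "nat filter topology" where
  "omega_star = subtopology beta_omega (topspace beta_omega - range omega_point)"

definition countably_compact_space :: "'a topology \<Rightarrow> bool" where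
  "countably_compact_space X \<longleftrightarrow>
     (\<forall>\<U>. countable \<U> \<and> (\<forall>U\<in>\<U>. openin X U) \<and> topspace X \<subseteq> \<Union>\<U>
        \<longrightarrow> (\<exists>\<F>. finite \<F> \<and> \<F> \<subseteq> \<U> \<and> topspace X \<subseteq> \<Union>\<F>))"

definition arrows_1_2 :: "'a topology \<Rightarrow> 'b topology \<Rightarrow> bool" where
  "arrows_1_2 X Y \<longleftrightarrow>
     (\<forall>P :: nat \<Rightarrow> 'a set. topspace X = P 0 \<union> P 1 \<longrightarrow>
        (\<exists>i\<in>{0, 1}. \<exists>Y'. Y' \<subseteq> P i \<and> subtopology X Y' homeomorphic_space Y))"


lemma ultrafilter_not_bot: "ultrafilter F \<Longrightarrow> F \<noteq> bot"
  by (simp add: ultrafilter_def)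

lemma ultrafilter_not:
  assumes "ultrafilter F"
  shows "eventually (\<lambda>x. \<not> P x) F \<longleftrightarrow> \<not> eventually P F"
proof
  assume "eventually (\<lambda>x. \<not> P x) F"
  then show "\<not> eventually P F"
    using assms eventually_conj[of "\<lambda>x. \<not> P x" F P] by (auto simp: ultrafilter_def)
qed (use assms in \<open>auto simp: ultrafilter_def\<close>)

lemma ultrafilter_finite_Bex:
  assumes "ultrafilter F" "finite \<A>" "eventually (\<lambda>x. \<exists>A\<in>\<A>. P A x) F"
  shows "\<exists>A\<in>\<A>. eventually (P A) F"
proof (rule ccontr)
  assume "\<not> (\<exists>A\<in>\<A>. eventually (P A) F)"
  then have "\<forall>A\<in>\<A>. eventually (\<lambda>x. \<not> P A x) F"
    using ultrafilter_not[OF assms(1)] by blast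
  then have "eventually (\<lambda>x. \<forall>A\<in>\<A>. \<not> P A x) F"
    by (simp add: assms(2) eventually_ball_finite)
  then have "eventually (\<lambda>x. \<not> (\<exists>A\<in>\<A>. P A x)) F" by simp
  with assms show False using ultrafilter_not by blast
qed

lemma ultrafilter_exists:
  assumes "F \<noteq> bot"
  shows "\<exists>U. ultrafilter U \<and> U \<le> F"
proof -
  define S where "S = {G. G \<noteq> bot \<and> G \<le> F}"
  have "\<exists>m\<in>S. \<forall>a\<in>S. m \<ge> a \<longrightarrow> a = m"
  proof (rule predicate_Zorn)
    show "partial_order_on S (relation_of (\<ge>) S)"
      by (rule partial_order_on_relation_ofI) auto
  next
    fix C assume C: "C \<in> Chains (relation_of (\<ge>) S)"
    then have CS: "C \<subseteq> S" and lin: "\<And>a b. a \<in> C \<Longrightarrow> b \<in> C \<Longrightarrow> a \<le> b \<or> b \<le> a"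
      by (auto simp: Chains_def relation_of_def)
    show "\<exists>u\<in>S. \<forall>a\<in>C. u \<le> a"
    proof (cases "C = {}")
      case True
      then show ?thesis using assms by (auto simp: S_def)
    next
      case False
      have "eventually (\<lambda>x. False) (Inf C) \<longleftrightarrow> (\<exists>b\<in>C. eventually (\<lambda>x. False) b)"
      proof (rule eventually_Inf_base[OF False])
        fix G H assume "G \<in> C" "H \<in> C"
        then show "\<exists>x\<in>C. x \<le> inf G H"
          using lin[of G H] by (metis inf.absorb1 inf.absorb2 order_refl)
      qed
      then have "Inf C \<noteq> bot"
        using CS by (auto simp: S_def eventually_False)
      moreover have "Inf C \<le> F"
      proof -
        obtain G where "G \<in> C" using False by blast
        then show ?thesis using CS Inf_lower2[of G C F] by (auto simp: S_def)
      qed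
      ultimately show ?thesis by (auto simp: S_def Inf_lower)
    qed
  qed
  then obtain m where m: "m \<noteq> bot" "m \<le> F"
    and max: "\<And>a. a \<noteq> bot \<Longrightarrow> a \<le> F \<Longrightarrow> a \<le> m \<Longrightarrow> a = m"
    unfolding S_def by blast
  have "eventually P m" if "\<not> eventually (\<lambda>x. \<not> P x) m" for P
  proof -
    have "inf m (principal {x. P x}) \<noteq> bot"
      using that by (simp add: eventually_inf_principal flip: eventually_False)
    then have "inf m (principal {x. P x}) = m"
      by (intro max) (auto intro: le_infI1 m)
    then show ?thesis
      by (metis eventually_principal inf.cobounded2 le_filter_def mem_Collect_eq)
  qed
  with m show ?thesis by (auto simp: ultrafilter_def)
qed

lemma ultrafilter_omega_point: "ultrafilter (omega_point n)"
  by (auto simp: ultrafilter_def omega_point_def eventually_principal principal_eq_bot_iff)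

lemma omega_point_in_beta_basic_iff [simp]: "omega_point n \<in> beta_basic A \<longleftrightarrow> n \<in> A"
  using ultrafilter_omega_point[of n] by (auto simp: beta_basic_def omega_point_def eventually_principal)

lemma beta_basic_Int: "beta_basic A \<inter> beta_basic B = beta_basic (A \<inter> B)"
  by (auto simp: beta_basic_def eventually_conj_iff)

lemma topspace_beta_omega: "topspace beta_omega = {F. ultrafilter F}"
  by (auto simp: beta_omega_def beta_basic_def intro!: exI[of _ UNIV])

lemma topspace_omega_star:
  "topspace omega_star = {F. ultrafilter F \<and> F \<notin> range omega_point}"
  by (auto simp: omega_star_def topspace_beta_omega)

lemma openin_beta_basic: "openin beta_omega (beta_basic A)"
  unfolding beta_omega_def by (rule topology_generated_by_Basis) simp

lemma openin_beta_omega_iff: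
  "openin beta_omega S \<longleftrightarrow> (\<forall>F\<in>S. \<exists>A. F \<in> beta_basic A \<and> beta_basic A \<subseteq> S)"
proof
  assume "openin beta_omega S"
  then have "generate_topology_on (range beta_basic) S"
    by (simp add: beta_omega_def openin_topology_generated_by)
  then show "\<forall>F\<in>S. \<exists>A. F \<in> beta_basic A \<and> beta_basic A \<subseteq> S"
  proof induction
    case (Int a b)
    show ?case
    proof
      fix F assume "F \<in> a \<inter> b"
      then obtain A B where "F \<in> beta_basic A" "beta_basic A \<subseteq> a" "F \<in> beta_basic B" "beta_basic B \<subseteq> b"
        using Int.IH by blast
      then show "\<exists>A. F \<in> beta_basic A \<and> beta_basic A \<subseteq> a \<inter> b"
        using beta_basic_Int[of A B] by (intro exI[of _ "A \<inter> B"]) blast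
    qed
  next
    case (UN K)
    then show ?case by (meson Sup_upper UnionE order_trans)
  qed auto
next
  assume "\<forall>F\<in>S. \<exists>A. F \<in> beta_basic A \<and> beta_basic A \<subseteq> S"
  then show "openin beta_omega S"
    by (subst openin_subopen) (meson openin_beta_basic)
qed

lemma Hausdorff_beta_omega: "Hausdorff_space beta_omega"
  unfolding Hausdorff_space_def
proof clarify
  fix F G assume FG: "F \<in> topspace beta_omega" "G \<in> topspace beta_omega" "F \<noteq> G"
  then have u: "ultrafilter F" "ultrafilter G" by (auto simp: topspace_beta_omega)
  obtain P where P: "eventually P F" "\<not> eventually P G"
    using \<open>F \<noteq> G\<close> u by (metis (no_types, lifting) filter_eq_iff ultrafilter_not)
  have "disjnt (beta_basic {x. P x}) (beta_basic {x. \<not> P x})"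
    by (auto simp: disjnt_def beta_basic_def ultrafilter_not)
  moreover have "F \<in> beta_basic {x. P x}" "G \<in> beta_basic {x. \<not> P x}"
    using P u by (auto simp: beta_basic_def ultrafilter_not)
  ultimately show "\<exists>U V. openin beta_omega U \<and> openin beta_omega V \<and> F \<in> U \<and> G \<in> V \<and> disjnt U V"
    using openin_beta_basic by blast
qed

lemma compact_beta_omega: "compact_space beta_omega"
  unfolding compact_space_alt
proof clarify
  fix \<U> assume op: "\<forall>U\<in>\<U>. openin beta_omega U" and cov: "topspace beta_omega \<subseteq> \<Union>\<U>"
  define \<A> where "\<A> = {A. \<exists>U\<in>\<U>. beta_basic A \<subseteq> U}"
  have "\<exists>\<B>. finite \<B> \<and> \<B> \<subseteq> \<A> \<and> \<Union>\<B> = UNIV"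
  proof (rule ccontr)
    assume no: "\<not> ?thesis"
    have "(INF A\<in>\<A>. principal (- A)) \<noteq> bot"
    proof (rule INF_filter_not_bot)
      fix \<B> assume "\<B> \<subseteq> \<A>" "finite \<B>"
      then have "(INF A\<in>\<B>. principal (- A)) = principal (\<Inter>A\<in>\<B>. - A)"
        by (simp add: INF_principal_finite)
      moreover have "(\<Inter>A\<in>\<B>. - A) \<noteq> {}"
      proof -
        have "\<Union>\<B> \<noteq> UNIV" using no \<open>\<B> \<subseteq> \<A>\<close> \<open>finite \<B>\<close> by blast
        then show ?thesis by blast
      qed
      ultimately show "(INF A\<in>\<B>. principal (- A)) \<noteq> bot"
        by (simp add: principal_eq_bot_iff)
    qed
    then obtain F where F: "ultrafilter F" "F \<le> (INF A\<in>\<A>. principal (- A))"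
      using ultrafilter_exists by blast
    then have "F \<in> topspace beta_omega" by (simp add: topspace_beta_omega)
    then obtain U where U: "U \<in> \<U>" "F \<in> U" using cov by blast
    then have "\<exists>A. F \<in> beta_basic A \<and> beta_basic A \<subseteq> U"
      using op openin_beta_omega_iff[of U] by blast
    then obtain A where A: "A \<in> \<A>" "F \<in> beta_basic A"
      unfolding \<A>_def using U(1) by blast
    then have "F \<le> principal (- A)" using F by (simp add: le_INF_iff)
    then have "eventually (\<lambda>n. n \<notin> A) F"
      by (simp add: le_principal)
    then show False using A F by (simp add: beta_basic_def ultrafilter_not)
  qed
  then obtain \<B> where \<B>: "finite \<B>" "\<B> \<subseteq> \<A>" "\<Union>\<B> = UNIV"
    by (elim exE conjE)
  have "\<forall>A\<in>\<B>. \<exists>U. U \<in> \<U> \<and> beta_basic A \<subseteq> U"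
    using \<B>(2) by (auto simp: \<A>_def)
  then obtain u where u: "\<And>A. A \<in> \<B> \<Longrightarrow> u A \<in> \<U> \<and> beta_basic A \<subseteq> u A"
    by (auto simp: bchoice_iff)
  have "topspace beta_omega \<subseteq> \<Union>(u ` \<B>)"
  proof
    fix F assume "F \<in> topspace beta_omega"
    then have F: "ultrafilter F" by (simp add: topspace_beta_omega)
    have "eventually (\<lambda>n. \<exists>A\<in>\<B>. n \<in> A) F"
      using \<B>(3) by (intro always_eventually) blast
    then obtain A where "A \<in> \<B>" "eventually (\<lambda>n. n \<in> A) F"
      using ultrafilter_finite_Bex[OF F \<B>(1), of "\<lambda>A n. n \<in> A"] by blast
    then show "F \<in> \<Union>(u ` \<B>)" using F u by (auto simp: beta_basic_def)
  qed
  then show "\<exists>\<F>. finite \<F> \<and> \<F> \<subseteq> \<U> \<and> topspace beta_omega \<subseteq> \<Union>\<F>"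
    using \<B>(1) u by (intro exI[of _ "u ` \<B>"]) auto
qed

lemma embedding_omega_point: "embedding_map (discrete_topology UNIV) beta_omega omega_point"
proof (rule injective_open_imp_embedding_map)
  show "continuous_map (discrete_topology UNIV) beta_omega omega_point"
    by (auto simp: continuous_map_from_discrete_topology topspace_beta_omega ultrafilter_omega_point)
  show "inj_on omega_point (topspace (discrete_topology UNIV))"
    by (auto simp: inj_on_def omega_point_def)
  have *: "F = omega_point n" if "F \<in> beta_basic {n}" for F n
  proof -
    have F: "ultrafilter F" "eventually (\<lambda>x. x = n) F"
      using that by (auto simp: beta_basic_def)
    have "eventually P F \<longleftrightarrow> P n" for P
    proof
      assume "P n"
      then show "eventually P F"
        by (auto intro: eventually_mono[OF F(2)])
    next
      assume P: "eventually P F"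
      have "eventually (\<lambda>x. P n) F"
        using eventually_conj[OF P F(2)] by (auto elim: eventually_mono)
      then show "P n"
        using eventually_happens'[OF ultrafilter_not_bot[OF F(1)]] by blast
    qed
    then show ?thesis
      by (simp add: filter_eq_iff omega_point_def eventually_principal)
  qed
  have "openin beta_omega (omega_point ` N)" for N
    unfolding openin_beta_omega_iff
  proof
    fix F assume "F \<in> omega_point ` N"
    then obtain n where n: "n \<in> N" "F = omega_point n" by blast
    then have "F \<in> beta_basic {n}" by simp
    moreover have "beta_basic {n} \<subseteq> omega_point ` N"
      using *[of _ n] n(1) by auto
    ultimately show "\<exists>A. F \<in> beta_basic A \<and> beta_basic A \<subseteq> omega_point ` N" by blast
  qed
  then show "open_map (discrete_topology UNIV) beta_omega omega_point"
    by (simp add: open_map_def)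
qed

lemma dense_omega_point: "beta_omega closure_of (range omega_point) = topspace beta_omega"
proof -
  have "\<exists>y\<in>range omega_point. y \<in> T" if T: "F \<in> T" "openin beta_omega T" for F T
  proof -
    obtain A where A: "F \<in> beta_basic A" "beta_basic A \<subseteq> T"
      using T openin_beta_omega_iff by blast
    then have "A \<noteq> {}" by (auto simp: beta_basic_def ultrafilter_def)
    then show ?thesis using A omega_point_in_beta_basic_iff by blast
  qed
  then show ?thesis by (auto simp: closure_of_def)
qed

lemma beta_omega_extension:
  fixes K :: "'k topology" and f :: "nat \<Rightarrow> 'k"
  assumes K: "compact_space K" "Hausdorff_space K" and f: "\<And>n. f n \<in> topspace K"
  shows "\<exists>g. continuous_map beta_omega K g \<and> (\<forall>n. g (omega_point n) = f n)"
proof -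
  have "\<exists>l. limitin K f l F" if F: "ultrafilter F" for F
  proof (rule ccontr)
    assume "\<nexists>l. limitin K f l F"
    then have "\<forall>l\<in>topspace K. \<exists>W. openin K W \<and> l \<in> W \<and> \<not> eventually (\<lambda>n. f n \<in> W) F"
      unfolding limitin_def by blast
    then obtain W where W: "\<And>l. l \<in> topspace K \<Longrightarrow> openin K (W l) \<and> l \<in> W l \<and> \<not> eventually (\<lambda>n. f n \<in> W l) F"
      by metis
    then have "(\<forall>U\<in>W ` topspace K. openin K U) \<and> topspace K \<subseteq> \<Union>(W ` topspace K)" by blast
    then obtain \<F> where \<F>: "finite \<F>" "\<F> \<subseteq> W ` topspace K" "topspace K \<subseteq> \<Union>\<F>"
      using K(1) unfolding compact_space_alt by meson
    have "eventually (\<lambda>n. \<exists>U\<in>\<F>. f n \<in> U) F"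
      using f \<F>(3) by (intro always_eventually) blast
    then obtain U where "U \<in> \<F>" "eventually (\<lambda>n. f n \<in> U) F"
      using ultrafilter_finite_Bex[OF F \<F>(1), of "\<lambda>U n. f n \<in> U"] by blast
    then show False using W \<F>(2) by blast
  qed
  then obtain g where g: "\<And>F. ultrafilter F \<Longrightarrow> limitin K f (g F) F" by metis
  have "continuous_map beta_omega K g"
    unfolding continuous_map_def
  proof (intro conjI allI impI)
    show "g \<in> topspace beta_omega \<rightarrow> topspace K"
      using g by (auto simp: topspace_beta_omega limitin_def)
    fix W assume W: "openin K W"
    show "openin beta_omega {F \<in> topspace beta_omega. g F \<in> W}"
      unfolding openin_beta_omega_iff
    proof
      fix F assume "F \<in> {F \<in> topspace beta_omega. g F \<in> W}"
      then have F: "ultrafilter F" "g F \<in> W" by (auto simp: topspace_beta_omega)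
      have "neighbourhood_base_of (closedin K) K"
        using K compact_Hausdorff_imp_regular_space neighbourhood_base_of_closedin by blast
      then obtain V C where VC: "openin K V" "closedin K C" "g F \<in> V" "V \<subseteq> C" "C \<subseteq> W"
        using W F(2) unfolding neighbourhood_base_of by meson
      have "F \<in> beta_basic {n. f n \<in> V}"
        using g[OF F(1)] VC F by (auto simp: limitin_def beta_basic_def)
      moreover have "g G \<in> W" if G: "G \<in> beta_basic {n. f n \<in> V}" for G
      proof -
        have "ultrafilter G" "eventually (\<lambda>n. f n \<in> C) G"
          using G VC(4) by (auto simp: beta_basic_def elim: eventually_mono)
        then have "g G \<in> C"
          using limitin_closedin[OF g VC(2)] ultrafilter_not_bot by blast
        then show ?thesis using VC(5) by blast
      qed
      ultimately show "\<exists>A. F \<in> beta_basic A \<and> beta_basic A \<subseteq> {F \<in> topspace beta_omega. g F \<in> W}"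
        by (intro exI[of _ "{n. f n \<in> V}"]) (auto simp: topspace_beta_omega beta_basic_def)
    qed
  qed
  moreover have "g (omega_point n) = f n" for n
  proof -
    have "limitin K f (f n) (omega_point n)"
      using f by (auto simp: limitin_def omega_point_def eventually_principal)
    then show ?thesis
      using limitin_Hausdorff_unique g ultrafilter_omega_point ultrafilter_not_bot K(2) by metis
  qed
  ultimately show ?thesis by blast
qed

theorem beta_omega_Stone_Cech:
  "compact_space beta_omega"
  "Hausdorff_space beta_omega"
  "embedding_map (discrete_topology UNIV) beta_omega omega_point"
  "beta_omega closure_of (range omega_point) = topspace beta_omega"
  "\<lbrakk>compact_space K; Hausdorff_space K; continuous_map (discrete_topology UNIV) K f\<rbrakk>
    \<Longrightarrow> \<exists>g. continuous_map beta_omega K g \<and> (\<forall>n. g (omega_point n) = f n)"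
proof -
  assume K: "compact_space K" "Hausdorff_space K" and f: "continuous_map (discrete_topology UNIV) K f"
  have "f n \<in> topspace K" for n
    using continuous_map_image_subset_topspace[OF f] by auto
  with K show "\<exists>g. continuous_map beta_omega K g \<and> (\<forall>n. g (omega_point n) = f n)"
    by (rule beta_omega_extension)
qed (fact compact_beta_omega Hausdorff_beta_omega embedding_omega_point dense_omega_point)+

theorem beta_omega_extension_unique:
  assumes "Hausdorff_space K" "continuous_map beta_omega K g" "continuous_map beta_omega K h"
    "\<And>n. g (omega_point n) = h (omega_point n)" "F \<in> topspace beta_omega"
  shows "g F = h F"
proof (rule forall_in_closure_of_eq[where X = beta_omega and Y = K and S = "range omega_point"])
  show "F \<in> beta_omega closure_of range omega_point"
    using assms(5) by (simp add: dense_omega_point)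
qed (use assms in auto)

end

theory Submission
  imports Defs
begin

text \<open>
  Fix one copy of \<open>Y\<close> in \<open>\<omega>\<^sup>*\<close>. It contains a discrete sequence \<open>d\<close>, and by countable
  compactness \<open>d\<close> converges in \<open>Y\<close> along some free ultrafilter \<open>u\<close>. Every copy of \<open>Y\<close> then
  contains a discrete sequence together with its \<open>u\<close>-limit, so it suffices to colour the
  ultrafilters on \<open>\<omega>\<close> in such a way that a \<open>u\<close>-limit of a discrete sequence \<open>x\<close> differs in colour
  from \<open>x n\<close> for \<open>u\<close>-many \<open>n\<close>.

  In the spirit of Frolik, the \<open>u\<close>-limit \<open>p\<close> determines \<open>x\<close> up to a \<open>u\<close>-null set, so the condition
  on \<open>p\<close> involves a single sequence. Iterating \<open>p \<mapsto> x\<close> may be possible infinitely often, so the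
  colouring cannot be defined by recursion. However, after shrinking to disjoint neighbourhoods
  the iterated sequences below \<open>p\<close> form a tree with distinct nodes, which can be coloured by the
  parity of the level, and Zorn's lemma patches these local colourings together.
\<close>

section \<open>Alternating colourings along an ultrafilter\<close>

lemma alternating_colouring_extension:
  fixes u :: "'i filter" and s :: "'x \<Rightarrow> 'i \<Rightarrow> 'x" and M :: "('x \<times> bool) set" and \<pi> :: "'x \<Rightarrow> bool"
  assumes u: "ultrafilter u"
    and sv: "single_valued M"
    and alt: "\<And>x b. (x, b) \<in> M \<Longrightarrow> x \<in> D \<Longrightarrow> \<forall>\<^sub>F n in u. (s x n, \<not> b) \<in> M"
    and T: "\<And>x. x \<in> T \<Longrightarrow> x \<in> D \<Longrightarrow> \<forall>\<^sub>F n in u. s x n \<in> T \<and> \<pi> (s x n) \<noteq> \<pi> x"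
  shows "\<exists>M'. M \<subseteq> M' \<and> T \<subseteq> Domain M' \<and> single_valued M' \<and>
           (\<forall>x b. (x, b) \<in> M' \<longrightarrow> x \<in> D \<longrightarrow> (\<forall>\<^sub>F n in u. (s x n, \<not> b) \<in> M'))"
proof -
  \<comment> \<open>\<open>E\<close> collects the points whose colour is to differ from \<open>\<pi>\<close>. Two alternating colourings
     differ by a colouring that is constant along the ultrafilter; that condition is monotone,
     so a fixed point of \<open>\<Phi>\<close> extends the given difference on \<open>M\<close>.\<close>
  define \<Phi> where "\<Phi> E = {x. if x \<in> Domain M then (x, \<not> \<pi> x) \<in> M else \<forall>\<^sub>F n in u. s x n \<in> E}" for E
  define E where "E = lfp \<Phi>"
  have "mono \<Phi>"
    by (auto simp: mono_def \<Phi>_def elim: eventually_mono)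
  then have E: "E = \<Phi> E"
    unfolding E_def by (rule lfp_unfold)
  have E_in: "x \<in> E \<longleftrightarrow> (x, \<not> \<pi> x) \<in> M" if "x \<in> Domain M" for x
    using that by (subst E) (simp add: \<Phi>_def)
  have E_out: "x \<in> E \<longleftrightarrow> (\<forall>\<^sub>F n in u. s x n \<in> E)" if "x \<notin> Domain M" for x
    using that by (subst E) (simp add: \<Phi>_def)
  define M' where "M' = M \<union> {(x, \<pi> x \<noteq> (x \<in> E)) | x. x \<in> T \<and> x \<notin> Domain M}"
  have M'_T: "(x, \<pi> x \<noteq> (x \<in> E)) \<in> M'" if "x \<in> T" for x
  proof (cases "x \<in> Domain M")
    case True
    then obtain b where "(x, b) \<in> M" by blast
    moreover have "b = (\<pi> x \<noteq> (x \<in> E))"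
    proof (cases "b = \<pi> x")
      case True
      have "(x, \<not> b) \<notin> M"
        using single_valuedD[OF sv \<open>(x, b) \<in> M\<close>] by blast
      then show ?thesis
        using E_in[OF \<open>x \<in> Domain M\<close>] True by simp
    next
      case False
      then have "b = (\<not> \<pi> x)" by simp
      then show ?thesis
        using E_in[OF \<open>x \<in> Domain M\<close>] \<open>(x, b) \<in> M\<close> by simp
    qed
    ultimately show ?thesis by (simp add: M'_def)
  next
    case False
    then show ?thesis using that by (auto simp: M'_def)
  qed
  have "single_valued M'"
    using sv by (auto simp: M'_def single_valued_def)
  moreover have "\<forall>\<^sub>F n in u. (s x n, \<not> b) \<in> M'" if xb: "(x, b) \<in> M'" and D: "x \<in> D" for x b
  proof (cases "(x, b) \<in> M")
    case True
    show ?thesis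
      by (rule eventually_mono[OF alt[OF True D]]) (simp add: M'_def)
  next
    case False
    with xb have x: "x \<in> T" "x \<notin> Domain M" "b = (\<pi> x \<noteq> (x \<in> E))"
      by (auto simp: M'_def)
    \<comment> \<open>Since \<open>u\<close> is an ultrafilter, failure of
      \<open>s x n \<in> E\<close> for \<open>u\<close>-many \<open>n\<close> means non-membership
      for \<open>u\<close>-many \<open>n\<close>. Hence \<open>E\<close> is constant along
      \<open>u\<close> off \<open>Domain M\<close>.\<close>
    have "\<forall>\<^sub>F n in u. (s x n \<in> E) = (x \<in> E)"
      using E_out[OF x(2)] ultrafilter_not[OF u, of "\<lambda>n. s x n \<in> E"] by (cases "x \<in> E") auto
    with T[OF x(1) D] show ?thesis
    proof eventually_elim
      case (elim n)
      then have "(\<pi> (s x n) \<noteq> (s x n \<in> E)) = (\<not> b)"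
        using x(3) by auto
      with M'_T[of "s x n"] elim show ?case by simp
    qed
  qed
  moreover have "T \<subseteq> Domain M'"
    using M'_T by blast
  moreover have "M \<subseteq> M'"
    by (simp add: M'_def)
  ultimately show ?thesis by blast
qed

text \<open>Zorn's lemma gives a maximal partial alternating colouring. The local colouring around a
  point \<open>p\<close> of \<open>D\<close> extends it to one defined at \<open>p\<close>, so by
  maximality \<open>p\<close> is already in its domain.\<close>

lemma alternating_colouring_exists:
  fixes u :: "'i filter" and s :: "'x \<Rightarrow> 'i \<Rightarrow> 'x"
  assumes u: "ultrafilter u"
    and local: "\<And>p. p \<in> D \<Longrightarrow> \<exists>T \<pi>. p \<in> T \<and>
      (\<forall>x\<in>T \<inter> D. \<forall>\<^sub>F n in u. s x n \<in> T \<and> \<pi> (s x n) \<noteq> (\<pi> x :: bool))"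
  shows "\<exists>c :: 'x \<Rightarrow> bool. \<forall>x\<in>D. \<forall>\<^sub>F n in u. c (s x n) \<noteq> c x"
proof -
  \<comment> \<open>Partial colourings are single-valued relations, so extension is inclusion and a
    chain is bounded by its union.\<close>
  define \<G> where "\<G> = {M. single_valued M \<and>
    (\<forall>x b. (x, b) \<in> M \<longrightarrow> x \<in> D \<longrightarrow> (\<forall>\<^sub>F n in u. (s x n, \<not> b) \<in> M))}"
  have "\<exists>M\<in>\<G>. \<forall>X\<in>\<G>. M \<subseteq> X \<longrightarrow> X = M"
  proof (rule subset_Zorn_nonempty)
    show "\<G> \<noteq> {}"
      by (auto simp: \<G>_def intro!: exI[of _ "{}"])
  next
    fix \<C> assume \<C>: "\<C> \<noteq> {}" "subset.chain \<G> \<C>"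
    have sv: "single_valued (\<Union>\<C>)"
    proof (rule single_valuedI)
      fix x a b assume "(x, a) \<in> \<Union>\<C>" "(x, b) \<in> \<Union>\<C>"
      then obtain A B where AB: "A \<in> \<C>" "B \<in> \<C>" "(x, a) \<in> A" "(x, b) \<in> B" by blast
      then have "A \<subseteq> B \<or> B \<subseteq> A" "single_valued A" "single_valued B"
        using \<C>(2) by (auto simp: subset_chain_def \<G>_def)
      with AB show "a = b" by (blast dest: single_valuedD)
    qed
    have "\<forall>\<^sub>F n in u. (s x n, \<not> b) \<in> \<Union>\<C>" if xb: "(x, b) \<in> \<Union>\<C>" "x \<in> D" for x b
    proof -
      obtain A where A: "A \<in> \<C>" "(x, b) \<in> A" using xb by blast
      then have "\<forall>\<^sub>F n in u. (s x n, \<not> b) \<in> A"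
        using \<C>(2) xb(2) by (auto simp: subset_chain_def \<G>_def)
      then show ?thesis by (rule eventually_mono) (use A in blast)
    qed
    with sv show "\<Union>\<C> \<in> \<G>" by (auto simp: \<G>_def)
  qed
  then obtain M where M: "M \<in> \<G>" and max: "\<And>X. X \<in> \<G> \<Longrightarrow> M \<subseteq> X \<Longrightarrow> X = M" by blast
  then have sv: "single_valued M"
    and alt: "\<And>x b. (x, b) \<in> M \<Longrightarrow> x \<in> D \<Longrightarrow> \<forall>\<^sub>F n in u. (s x n, \<not> b) \<in> M"
    by (auto simp: \<G>_def)
  have dom: "p \<in> Domain M" if p: "p \<in> D" for p
  proof -
    obtain T \<pi> where T: "p \<in> T"
      "\<And>x. x \<in> T \<Longrightarrow> x \<in> D \<Longrightarrow> \<forall>\<^sub>F n in u. s x n \<in> T \<and> \<pi> (s x n) \<noteq> (\<pi> x :: bool)"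
      using local[OF p] by blast
    obtain M' where M': "M \<subseteq> M'" "T \<subseteq> Domain M'" "M' \<in> \<G>"
      using alternating_colouring_extension[of u M D s T \<pi>, OF u sv alt T(2)]
      unfolding \<G>_def by auto
    then have "M' = M" using max by blast
    with M' T show ?thesis by blast
  qed
  have "\<forall>\<^sub>F n in u. ((s x n, True) \<in> M) \<noteq> ((x, True) \<in> M)" if x: "x \<in> D" for x
  proof -
    obtain b where b: "(x, b) \<in> M" using dom[OF x] by blast
    show ?thesis
      using alt[OF b x]
    proof eventually_elim
      case (elim n)
      then show ?case
        using b sv by (cases b) (auto dest: single_valuedD)
    qed
  qed
  \<comment> \<open>Off \<open>Domain M\<close> the colour defaults to \<open>False\<close>. This is
    harmless: each \<open>x\<close> in \<open>D\<close> and \<open>u\<close>-many of its successors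
    lie in \<open>Domain M\<close>.\<close>
  then show ?thesis
    by (intro exI[of _ "\<lambda>x. (x, True) \<in> M"]) blast
qed

section \<open>Self-maps fixing an ultrafilter\<close>

text \<open>Parity of the length of the descending run \<open>n > f n > f (f n) > ...\<close>, with
  value \<open>True\<close> where the descent stops. The guard makes every recursive call smaller,
  so the recursion terminates for arbitrary \<open>f\<close>.\<close>

fun descent_parity :: "(nat \<Rightarrow> nat) \<Rightarrow> nat \<Rightarrow> bool" where
  "descent_parity f n = (if f n < n then \<not> descent_parity f (f n) else True)"

declare descent_parity.simps [simp del]

text \<open>Orbits of \<open>g\<close> may merge, so positions along orbits do not define a global
  parity. Along a single orbit they do, and the patching lemma for the trivial ultrafilter on one
  point, where "eventually" means truth, glues these local parities.\<close>

lemma increasing_map_colouring: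
  fixes g :: "nat \<Rightarrow> nat"
  assumes g: "\<And>n. n < g n"
  shows "\<exists>c :: nat \<Rightarrow> bool. \<forall>n. c (g n) \<noteq> c n"
proof -
  have "ultrafilter (principal {()})"
    by (auto simp: ultrafilter_def eventually_principal principal_eq_bot_iff)
  moreover have "\<exists>T \<pi>. p \<in> T \<and>
      (\<forall>x\<in>T \<inter> UNIV. \<forall>\<^sub>F n in principal {()}. g x \<in> T \<and> \<pi> (g x) \<noteq> (\<pi> x :: bool))" for p
  proof -
    define r where "r k = (g ^^ k) p" for k
    have "strict_mono r"
      by (simp add: strict_mono_Suc_iff r_def g)
    then have inv_r: "inv r (r k) = k" for k
      by (simp add: strict_mono_imp_inj_on)
    have g_r: "g (r k) = r (Suc k)" for k
      by (simp add: r_def)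
    have "p = r 0" by (simp add: r_def)
    then show ?thesis
      by (intro exI[of _ "range r"] exI[of _ "\<lambda>x. even (inv r x)"])
         (auto simp: eventually_principal g_r inv_r)
  qed
  ultimately have "\<exists>c :: nat \<Rightarrow> bool. \<forall>x\<in>UNIV. \<forall>\<^sub>F n in principal {()}. c (g x) \<noteq> c x"
    by (rule alternating_colouring_exists)
  then show ?thesis by (simp add: eventually_principal)
qed

text \<open>The image of \<open>u\<close> under \<open>f\<close> is \<open>u\<close>, and every
  2-colouring is constant on a set in \<open>u\<close>, so none can alternate along \<open>f\<close>
  on a set in \<open>u\<close>. Descending and ascending \<open>f\<close> both admit such
  colourings, which leaves only \<open>f n = n\<close>.\<close>

lemma ultrafilter_fixed_imp_eventually_id:
  fixes f :: "nat \<Rightarrow> nat"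
  assumes u: "ultrafilter u"
    and fix_u: "\<And>P. eventually P u \<Longrightarrow> \<forall>\<^sub>F n in u. P (f n)"
  shows "\<forall>\<^sub>F n in u. f n = n"
proof -
  have no_alt: "\<not> (\<forall>\<^sub>F n in u. c (f n) \<noteq> c n)" for c :: "nat \<Rightarrow> bool"
  proof
    assume alt: "\<forall>\<^sub>F n in u. c (f n) \<noteq> c n"
    obtain b where b: "\<forall>\<^sub>F n in u. c n = b"
    proof (cases "eventually c u")
      case True
      then show ?thesis using that[of True] by simp
    next
      case False
      then show ?thesis using that[of False] ultrafilter_not[OF u] by simp
    qed
    from fix_u[OF b] b alt have "\<forall>\<^sub>F n in u. False"
      by eventually_elim auto
    then show False using u by (simp add: ultrafilter_def)
  qed
  have "\<not> (\<forall>\<^sub>F n in u. f n < n)"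
  proof
    assume "\<forall>\<^sub>F n in u. f n < n"
    then have "\<forall>\<^sub>F n in u. descent_parity f (f n) \<noteq> descent_parity f n"
      by eventually_elim (subst (2) descent_parity.simps, simp)
    then show False using no_alt by blast
  qed
  moreover have "\<not> (\<forall>\<^sub>F n in u. n < f n)"
  proof
    assume less: "\<forall>\<^sub>F n in u. n < f n"
    \<comment> \<open>\<open>g\<close> agrees with \<open>f\<close> on a set in \<open>u\<close> and
      is increasing everywhere.\<close>
    define g where "g n = (if n < f n then f n else Suc n)" for n
    have "n < g n" for n
      by (simp add: g_def)
    then obtain c :: "nat \<Rightarrow> bool" where c: "\<And>n. c (g n) \<noteq> c n"
      using increasing_map_colouring[of g] by blast
    from less have "\<forall>\<^sub>F n in u. c (f n) \<noteq> c n"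
    proof eventually_elim
      case (elim n)
      then show ?case using c[of n] by (simp add: g_def)
    qed
    then show False using no_alt by blast
  qed
  ultimately have "\<forall>\<^sub>F n in u. \<not> f n < n" "\<forall>\<^sub>F n in u. \<not> n < f n"
    using ultrafilter_not[OF u] by blast+
  then show ?thesis by eventually_elim simp
qed

section \<open>Limits of separated sequences of ultrafilters\<close>

text \<open>For ultrafilters this is the limit of \<open>x\<close> along \<open>u\<close> in the
  Stone space, also known as the sum of the \<open>x n\<close> over \<open>u\<close>.\<close>

definition ultralimit :: "'i filter \<Rightarrow> ('i \<Rightarrow> 'a filter) \<Rightarrow> 'a filter \<Rightarrow> bool" where
  "ultralimit u x p \<longleftrightarrow> (\<forall>P. eventually P p \<longleftrightarrow> (\<forall>\<^sub>F n in u. eventually P (x n)))"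

definition separates :: "('i \<Rightarrow> 'a set) \<Rightarrow> ('i \<Rightarrow> 'a filter) \<Rightarrow> bool" where
  "separates A x \<longleftrightarrow> disjoint_family A \<and> (\<forall>n. ultrafilter (x n) \<and> (\<forall>\<^sub>F k in x n. k \<in> A n))"

lemma ultrafilter_contradiction:
  assumes "ultrafilter F" "eventually P F" "eventually Q F" "\<And>k. P k \<Longrightarrow> Q k \<Longrightarrow> False"
  shows False
proof -
  have "\<forall>\<^sub>F k in F. False"
    using assms(2,3) by eventually_elim (rule assms(4))
  then show False using assms(1) by (simp add: ultrafilter_def)
qed

lemma ultrafilters_distinguished:
  assumes "ultrafilter F" "ultrafilter G" "F \<noteq> G"
  shows "\<exists>P. eventually P F \<and> (\<forall>\<^sub>F k in G. \<not> P k)"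
proof (rule ccontr)
  assume "\<not> ?thesis"
  then have imp: "eventually P F \<Longrightarrow> eventually P G" for P
    using ultrafilter_not[OF assms(2), of P] by blast
  then have "eventually P F = eventually P G" for P
    using ultrafilter_not[OF assms(1), of P] ultrafilter_not[OF assms(2), of P] by blast
  then show False using assms(3) by (simp add: filter_eq_iff)
qed

lemma separatesD:
  assumes "separates A x"
  shows "ultrafilter (x n)" "\<forall>\<^sub>F k in x n. k \<in> A n" "k \<in> A m \<Longrightarrow> k \<in> A n \<Longrightarrow> m = n"
  using assms by (auto simp: separates_def disjoint_family_on_def)

text \<open>Let \<open>f n\<close> be an index with \<open>B (f n)\<close> in \<open>x n\<close>. As
  both sequences have the limit \<open>p\<close>, the map \<open>f\<close> fixes \<open>u\<close>,
  so \<open>f n = n\<close> for \<open>u\<close>-many \<open>n\<close> and \<open>x n\<close>,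
  \<open>y n\<close> both contain \<open>B n\<close>. If they differed \<open>u\<close>-often,
  distinguishing sets cut down to the disjoint \<open>B n\<close> would glue to a set on which the
  two limits disagree.\<close>

lemma ultralimit_unique_aux:
  fixes x y :: "nat \<Rightarrow> 'a filter"
  assumes u: "ultrafilter u" and x: "\<And>n. ultrafilter (x n)" and B: "separates B y"
    and p: "ultralimit u x p" "ultralimit u y p"
    and ex: "\<forall>\<^sub>F n in u. \<exists>m. \<forall>\<^sub>F k in x n. k \<in> B m"
  shows "\<forall>\<^sub>F n in u. x n = y n"
proof -
  define f where "f n = (SOME m. \<forall>\<^sub>F k in x n. k \<in> B m)" for n
  have f: "\<forall>\<^sub>F n in u. \<forall>\<^sub>F k in x n. k \<in> B (f n)"
    using ex unfolding f_def by (rule eventually_mono) (rule someI_ex)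
  have "\<forall>\<^sub>F n in u. f n = n"
  proof (rule ultrafilter_fixed_imp_eventually_id[OF u])
    fix P assume P: "eventually P u"
    have "\<forall>\<^sub>F n in u. \<forall>\<^sub>F k in y n. \<exists>m. P m \<and> k \<in> B m"
      using P
    proof eventually_elim
      case (elim n)
      show ?case
        by (rule eventually_mono[OF separatesD(2)[OF B, of n]]) (use elim in blast)
    qed
    then have "\<forall>\<^sub>F n in u. \<forall>\<^sub>F k in x n. \<exists>m. P m \<and> k \<in> B m"
      using p by (simp add: ultralimit_def)
    with f show "\<forall>\<^sub>F n in u. P (f n)"
    proof eventually_elim
      case (elim n)
      show ?case
      proof (rule ccontr)
        assume "\<not> P (f n)"
        then show False
          by - (rule ultrafilter_contradiction[OF x elim], use separatesD(3)[OF B] in metis)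
      qed
    qed
  qed
  with f have xB: "\<forall>\<^sub>F n in u. \<forall>\<^sub>F k in x n. k \<in> B n"
    by eventually_elim simp
  show ?thesis
  proof (rule ccontr)
    assume "\<not> ?thesis"
    then have ne: "\<forall>\<^sub>F n in u. x n \<noteq> y n"
      using ultrafilter_not[OF u] by blast
    have "\<exists>S. x n \<noteq> y n \<longrightarrow> eventually S (x n) \<and> eventually (\<lambda>k. \<not> S k) (y n)" for n
      using ultrafilters_distinguished[OF x[of n] separatesD(1)[OF B, of n]] by blast
    then obtain S where S: "\<And>n. x n \<noteq> y n \<Longrightarrow> eventually (S n) (x n) \<and> eventually (\<lambda>k. \<not> S n k) (y n)"
      by metis
    have "\<forall>\<^sub>F n in u. \<forall>\<^sub>F k in x n. \<exists>m. k \<in> B m \<and> S m k"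
      using xB ne
    proof eventually_elim
      case (elim n)
      then have "eventually (S n) (x n)" using S by blast
      with elim(1) show ?case by eventually_elim blast
    qed
    then have "\<forall>\<^sub>F n in u. \<forall>\<^sub>F k in y n. \<exists>m. k \<in> B m \<and> S m k"
      using p by (simp add: ultralimit_def)
    with ne have "\<forall>\<^sub>F n in u. False"
    proof eventually_elim
      case (elim n)
      have "\<forall>\<^sub>F k in y n. k \<in> B n \<and> \<not> S n k"
        using S[OF elim(1)] separatesD(2)[OF B, of n] by (simp add: eventually_conj_iff)
      then show False
        by - (rule ultrafilter_contradiction[OF separatesD(1)[OF B] elim(2)], assumption, use separatesD(3)[OF B] in metis)
    qed
    then show False using u by (simp add: ultrafilter_def)
  qed
qed

text \<open>If \<open>u\<close>-many \<open>x n\<close> contain some \<open>B m\<close>, or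
  \<open>u\<close>-many \<open>y n\<close> some \<open>A m\<close>, the preceding lemma applies.
  Otherwise the two families can be made disjoint, which contradicts the common limit.\<close>

lemma ultralimit_unique:
  fixes x y :: "nat \<Rightarrow> 'a filter"
  assumes u: "ultrafilter u" and A: "separates A x" and B: "separates B y"
    and p: "ultralimit u x p" "ultralimit u y p"
  shows "\<forall>\<^sub>F n in u. x n = y n"
proof (rule ccontr)
  assume neq: "\<not> ?thesis"
  have "\<not> (\<forall>\<^sub>F n in u. \<exists>m. \<forall>\<^sub>F k in x n. k \<in> B m)"
    using ultralimit_unique_aux[OF u separatesD(1)[OF A] B p] neq by blast
  then have xB: "\<forall>\<^sub>F n in u. \<forall>m. \<forall>\<^sub>F k in x n. k \<notin> B m"
    using ultrafilter_not[OF u, of "\<lambda>n. \<exists>m. \<forall>\<^sub>F k in x n. k \<in> B m"]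
    by (simp add: ultrafilter_not[OF separatesD(1)[OF A]])
  have "\<not> (\<forall>\<^sub>F n in u. \<exists>m. \<forall>\<^sub>F k in y n. k \<in> A m)"
    using ultralimit_unique_aux[OF u separatesD(1)[OF B] A p(2,1)] neq
    unfolding eq_commute[of "y _"] by blast
  then have yA: "\<forall>\<^sub>F n in u. \<forall>m. \<forall>\<^sub>F k in y n. k \<notin> A m"
    using ultrafilter_not[OF u, of "\<lambda>n. \<exists>m. \<forall>\<^sub>F k in y n. k \<in> A m"]
    by (simp add: ultrafilter_not[OF separatesD(1)[OF B]])
  \<comment> \<open>Removing from the \<open>n\<close>-th set of each family the first \<open>n\<close> sets of the other one makes
     the unions of the two families disjoint, although both belong to \<open>p\<close>.\<close>
  define X where "X k \<longleftrightarrow> (\<exists>n. k \<in> A n \<and> (\<forall>m\<le>n. k \<notin> B m))" for k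
  define Y where "Y k \<longleftrightarrow> (\<exists>n. k \<in> B n \<and> (\<forall>m\<le>n. k \<notin> A m))" for k
  have "\<forall>\<^sub>F n in u. eventually X (x n)"
    using xB
  proof eventually_elim
    case (elim n)
    then have "\<forall>\<^sub>F k in x n. \<forall>m\<in>{..n}. k \<notin> B m"
      by (intro eventually_ball_finite) auto
    with separatesD(2)[OF A, of n] show ?case
      by eventually_elim (auto simp: X_def)
  qed
  moreover have "\<forall>\<^sub>F n in u. eventually Y (y n)"
    using yA
  proof eventually_elim
    case (elim n)
    then have "\<forall>\<^sub>F k in y n. \<forall>m\<in>{..n}. k \<notin> A m"
      by (intro eventually_ball_finite) auto
    with separatesD(2)[OF B, of n] show ?case
      by eventually_elim (auto simp: Y_def)
  qed
  ultimately have "\<forall>\<^sub>F n in u. eventually X (x n)" "\<forall>\<^sub>F n in u. eventually Y (x n)"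
    using p by (simp_all add: ultralimit_def)
  then have "\<forall>\<^sub>F n in u. False"
  proof eventually_elim
    case (elim n)
    \<comment> \<open>Of the two witnessing indices, the smaller one is excluded by the condition
      attached to the other.\<close>
    have "\<not> (X k \<and> Y k)" for k
      unfolding X_def Y_def by (metis nat_le_linear)
    then show False
      by - (rule ultrafilter_contradiction[OF separatesD(1)[OF A] elim], blast)
  qed
  then show False using u by (simp add: ultrafilter_def)
qed

section \<open>The tree below an iterated limit\<close>

text \<open>Nodes are lists of branch labels with the most recent label first.\<close>

primrec tree_point :: "('x \<Rightarrow> 'i \<Rightarrow> 'x) \<Rightarrow> 'x \<Rightarrow> 'i list \<Rightarrow> 'x" where
  "tree_point s p [] = p"
| "tree_point s p (n # l) = s (tree_point s p l) n"

primrec tree_nbhd :: "('x \<Rightarrow> 'i \<Rightarrow> 'x) \<Rightarrow> ('x \<Rightarrow> 'i \<Rightarrow> 'a set) \<Rightarrow> 'x \<Rightarrow> 'i list \<Rightarrow> 'a set" where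
  "tree_nbhd s V p [] = UNIV"
| "tree_nbhd s V p (n # l) = V (tree_point s p l) n \<inter> tree_nbhd s V p l"

text \<open>A branch is kept only if the child ultrafilter contains the neighbourhood of its parent.
  This realises the shrinking to nested neighbourhoods without changing \<open>V\<close>. Branching
  happens only at points of \<open>D\<close>, where \<open>s\<close> and \<open>V\<close> are
  meaningful.\<close>

primrec tree_node ::
    "('a filter \<Rightarrow> 'i \<Rightarrow> 'a filter) \<Rightarrow> ('a filter \<Rightarrow> 'i \<Rightarrow> 'a set) \<Rightarrow> 'a filter set \<Rightarrow> 'a filter \<Rightarrow> 'i list \<Rightarrow> bool" where
  "tree_node s V D p [] \<longleftrightarrow> True"
| "tree_node s V D p (n # l) \<longleftrightarrow> tree_node s V D p l \<and> tree_point s p l \<in> D \<and>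
     (\<forall>\<^sub>F k in s (tree_point s p l) n. k \<in> tree_nbhd s V p l)"

lemma tree_nbhd_append: "tree_nbhd s V p (k @ l) \<subseteq> tree_nbhd s V p l"
  by (induction k) auto

lemma tree_node_append: "tree_node s V D p (k @ l) \<Longrightarrow> tree_node s V D p l"
  by (induction k) auto

lemma tree_node_nbhd:
  assumes "\<And>x. x \<in> D \<Longrightarrow> separates (V x) (s x)" "tree_node s V D p l"
  shows "\<forall>\<^sub>F k in tree_point s p l. k \<in> tree_nbhd s V p l"
proof (cases l)
  case (Cons n l')
  then show ?thesis
    using assms separatesD(2)[OF assms(1)] by (auto simp: eventually_conj_iff)
qed simp

lemma tree_node_ultrafilter:
  assumes "\<And>x. x \<in> D \<Longrightarrow> separates (V x) (s x)" "tree_node s V D p l" "ultrafilter p"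
  shows "ultrafilter (tree_point s p l)"
  using assms separatesD(1)[OF assms(1)] by (cases l) auto

lemma tree_nbhd_same_level:
  assumes "\<And>x. x \<in> D \<Longrightarrow> separates (V x) (s x)"
    and "tree_node s V D p l" "tree_node s V D p l'" "length l = length l'"
    and "k \<in> tree_nbhd s V p l" "k \<in> tree_nbhd s V p l'"
  shows "l = l'"
  using assms(4,2,3,5,6)
proof (induction l l' rule: list_induct2)
  case (Cons n l n' l')
  then have "l = l'" by simp
  moreover have "n = n'"
    using Cons.prems \<open>l = l'\<close> separatesD(3)[OF assms(1)] by auto
  ultimately show ?case by simp
qed simp

text \<open>Compare \<open>l\<close> with the ancestor \<open>m\<close> of \<open>l'\<close> at the
  level of \<open>l\<close>. If \<open>m\<close> differs from \<open>l\<close>, the two nodes have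
  disjoint neighbourhoods. If \<open>m = l\<close> and \<open>l'\<close> is longer, its
  neighbourhood lies in some \<open>V x n\<close> with \<open>x\<close> the point at
  \<open>l\<close>, and \<open>proper\<close> says that \<open>x\<close> does not contain this
  set.\<close>

lemma tree_point_inj_le:
  assumes sep: "\<And>x. x \<in> D \<Longrightarrow> separates (V x) (s x)"
    and proper: "\<And>x n. x \<in> D \<Longrightarrow> \<forall>\<^sub>F k in x. k \<notin> V x n"
    and p: "ultrafilter p"
    and l: "tree_node s V D p l" "tree_node s V D p l'" "length l \<le> length l'"
    and eq: "tree_point s p l = tree_point s p l'"
  shows "l = l'"
proof -
  define j where "j = take (length l' - length l) l'"
  define m where "m = drop (length l' - length l) l'"
  have l': "l' = j @ m" and len: "length m = length l"
    using l(3) by (simp_all add: j_def m_def)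
  have m: "tree_node s V D p m" using l(2) tree_node_append unfolding l' by blast
  have ult: "ultrafilter (tree_point s p l)"
    using tree_node_ultrafilter[OF sep l(1) p] .
  have in_l: "\<forall>\<^sub>F k in tree_point s p l. k \<in> tree_nbhd s V p l"
    using tree_node_nbhd[OF sep l(1)] .
  have in_l': "\<forall>\<^sub>F k in tree_point s p l. k \<in> tree_nbhd s V p l'"
    using tree_node_nbhd[OF sep l(2)] by (simp add: eq)
  have ml: "m = l"
  proof (rule ccontr)
    assume "m \<noteq> l"
    then show False
      using tree_nbhd_same_level[OF sep l(1) m] len tree_nbhd_append[of s V p j m]
      by - (rule ultrafilter_contradiction[OF ult in_l in_l'], auto simp: l')
  qed
  show ?thesis
  proof (cases j rule: rev_exhaust)
    case Nil
    then show ?thesis using ml l' by simp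
  next
    case (snoc j' n)
    then have l'_eq: "l' = j' @ (n # l)" using ml l' by simp
    then have "tree_node s V D p (n # l)" using l(2) tree_node_append by blast
    then have D: "tree_point s p l \<in> D" by simp
    have "tree_nbhd s V p l' \<subseteq> V (tree_point s p l) n"
      using tree_nbhd_append[of s V p j' "n # l"] by (auto simp: l'_eq)
    then have False
      by - (rule ultrafilter_contradiction[OF ult in_l' proper[OF D, of n]], blast)
    then show ?thesis ..
  qed
qed

text \<open>\<open>T\<close> consists of the points of the tree below \<open>p\<close>; by
  injectivity the parity of the level is well defined on it. The neighbourhood of a node belongs to
  its point \<open>x\<close>, hence to \<open>s x n\<close> for \<open>u\<close>-many
  \<open>n\<close>, and these children are nodes again.\<close>

lemma ultralimit_tree_parity:
  fixes s :: "'a filter \<Rightarrow> 'i \<Rightarrow> 'a filter"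
  assumes sep: "\<And>x. x \<in> D \<Longrightarrow> separates (V x) (s x)"
    and proper: "\<And>x n. x \<in> D \<Longrightarrow> \<forall>\<^sub>F k in x. k \<notin> V x n"
    and lim: "\<And>x. x \<in> D \<Longrightarrow> ultralimit u (s x) x"
    and p: "ultrafilter p"
  shows "\<exists>T \<pi>. p \<in> T \<and> (\<forall>x\<in>T \<inter> D. \<forall>\<^sub>F n in u. s x n \<in> T \<and> \<pi> (s x n) \<noteq> (\<pi> x :: bool))"
proof -
  define N where "N = {l. tree_node s V D p l}"
  have inj: "inj_on (tree_point s p) N"
  proof (rule inj_onI)
    fix l l' assume "l \<in> N" "l' \<in> N" "tree_point s p l = tree_point s p l'"
    then show "l = l'"
      using tree_point_inj_le[OF sep proper p, where l = l and l' = l']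
        tree_point_inj_le[OF sep proper p, where l = l' and l' = l]
      by (cases "length l \<le> length l'") (auto simp: N_def)
  qed
  define \<pi> where "\<pi> x = even (length (the_inv_into N (tree_point s p) x))" for x
  have \<pi>: "\<pi> (tree_point s p l) = even (length l)" if "l \<in> N" for l
    using that by (simp add: \<pi>_def the_inv_into_f_f[OF inj])
  have "\<forall>\<^sub>F n in u. s x n \<in> tree_point s p ` N \<and> \<pi> (s x n) \<noteq> \<pi> x"
    if x: "x \<in> tree_point s p ` N" "x \<in> D" for x
  proof -
    obtain l where l: "l \<in> N" "x = tree_point s p l" using x by blast
    have "\<forall>\<^sub>F k in x. k \<in> tree_nbhd s V p l"
      using tree_node_nbhd[OF sep, where l = l] l by (simp add: N_def)
    then have "\<forall>\<^sub>F n in u. \<forall>\<^sub>F k in s x n. k \<in> tree_nbhd s V p l"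
      using lim[OF x(2)] by (simp add: ultralimit_def)
    then show ?thesis
    proof eventually_elim
      case (elim n)
      then have n: "n # l \<in> N" using l x(2) by (simp add: N_def)
      have "tree_point s p (n # l) = s x n" by (simp add: l)
      then show ?case using \<pi>[OF n] \<pi>[OF l(1)] n l by (metis even_Suc image_eqI length_Cons)
    qed
  qed
  moreover have "p = tree_point s p []" "[] \<in> N" by (simp_all add: N_def)
  ultimately show ?thesis
    by (intro exI[of _ "tree_point s p ` N"] exI[of _ \<pi>]) blast
qed

text \<open>Choose one separated sequence for each limit point and colour along it. By uniqueness of
  the sequence modulo \<open>u\<close>, the colouring alternates along every other one as
  well.\<close>

lemma ultralimit_colouring:
  assumes u: "ultrafilter u" "u \<le> sequentially"
  shows "\<exists>c :: 'a filter \<Rightarrow> bool. \<forall>A x p. separates A x \<longrightarrow> ultrafilter p \<longrightarrow> ultralimit u x p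
           \<longrightarrow> (\<forall>\<^sub>F n in u. c (x n) \<noteq> c p)"
proof -
  define D where "D = {p :: 'a filter. ultrafilter p \<and> (\<exists>A x. separates A x \<and> ultralimit u x p)}"
  have "\<forall>p\<in>D. \<exists>A x. separates A x \<and> ultralimit u x p" by (auto simp: D_def)
  then obtain V s where sep: "\<And>p. p \<in> D \<Longrightarrow> separates (V p) (s p)"
    and lim: "\<And>p. p \<in> D \<Longrightarrow> ultralimit u (s p) p"
    by metis
  \<comment> \<open>As \<open>u\<close> is free, the single index \<open>n\<close> is negligible,
    and the other terms avoid \<open>V x n\<close> by disjointness.\<close>
  have proper: "\<forall>\<^sub>F k in x. k \<notin> V x n" if x: "x \<in> D" for x n
  proof -
    have "\<forall>\<^sub>F m in sequentially. m \<noteq> n"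
      by (rule eventually_mono[OF eventually_gt_at_top[of n]]) simp
    with u(2) have "\<forall>\<^sub>F m in u. m \<noteq> n"
      by (rule filter_leD)
    then have "\<forall>\<^sub>F m in u. \<forall>\<^sub>F k in s x m. k \<notin> V x n"
    proof eventually_elim
      case (elim m)
      show ?case
        by (rule eventually_mono[OF separatesD(2)[OF sep[OF x], of m]])
           (use elim separatesD(3)[OF sep[OF x]] in blast)
    qed
    then show ?thesis using lim[OF x] by (simp add: ultralimit_def)
  qed
  have "\<exists>T \<pi>. p \<in> T \<and> (\<forall>x\<in>T \<inter> D. \<forall>\<^sub>F n in u. s x n \<in> T \<and> \<pi> (s x n) \<noteq> (\<pi> x :: bool))"
    if "p \<in> D" for p
    using ultralimit_tree_parity[of D V s u p] sep proper lim that unfolding D_def by blast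
  then obtain c :: "'a filter \<Rightarrow> bool" where c: "\<And>x. x \<in> D \<Longrightarrow> \<forall>\<^sub>F n in u. c (s x n) \<noteq> c x"
    using alternating_colouring_exists[OF u(1), of D s] by blast
  have "\<forall>\<^sub>F n in u. c (x n) \<noteq> c p" if "separates A x" "ultrafilter p" "ultralimit u x p" for A x p
  proof -
    have p: "p \<in> D" using that by (auto simp: D_def)
    have "\<forall>\<^sub>F n in u. x n = s p n"
      using ultralimit_unique[OF u(1) that(1) sep[OF p] that(3) lim[OF p]] .
    with c[OF p] show ?thesis by eventually_elim simp
  qed
  then show ?thesis by blast
qed

section \<open>Discrete sequences in copies of a space\<close>

lemma countably_compact_space_ultralimit:
  assumes Y: "countably_compact_space Y" and d: "\<And>n::nat. d n \<in> topspace Y"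
  shows "\<exists>u q. ultrafilter u \<and> u \<le> sequentially \<and> limitin Y d q u"
proof -
  have "\<exists>q\<in>topspace Y. \<forall>U. openin Y U \<and> q \<in> U \<longrightarrow> infinite {n. d n \<in> U}"
  proof (rule ccontr)
    assume no: "\<not> ?thesis"
    \<comment> \<open>If every point had a neighbourhood meeting \<open>d\<close> in finitely many
      indices, grouping these open sets by their finite index sets would give a countable cover; a
      finite subcover would leave only finitely many indices.\<close>
    define O' where "O' F = \<Union>{U. openin Y U \<and> {n. d n \<in> U} = F}" for F
    have "countable (O' ` Collect finite)"
      using countable_Collect_finite by blast
    moreover have "\<forall>U\<in>O' ` Collect finite. openin Y U"
      by (auto simp: O'_def)
    moreover have "topspace Y \<subseteq> \<Union>(O' ` Collect finite)"
    proof
      fix q assume "q \<in> topspace Y"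
      then obtain U where U: "openin Y U" "q \<in> U" "finite {n. d n \<in> U}"
        using no by blast
      then have "q \<in> O' {n. d n \<in> U}" by (auto simp: O'_def)
      with U(3) show "q \<in> \<Union>(O' ` Collect finite)" by blast
    qed
    ultimately obtain \<F> where \<F>: "finite \<F>" "\<F> \<subseteq> O' ` Collect finite" "topspace Y \<subseteq> \<Union>\<F>"
      using Y unfolding countably_compact_space_def by meson
    then obtain \<K> where \<K>: "finite \<K>" "\<K> \<subseteq> Collect finite" "\<F> = O' ` \<K>"
      by (meson finite_subset_image)
    have "n \<in> \<Union>\<K>" for n
    proof -
      obtain F where "F \<in> \<K>" "d n \<in> O' F" using d[of n] \<F>(3) \<K>(3) by blast
      then show ?thesis by (auto simp: O'_def)
    qed
    then have "\<Union>\<K> = UNIV" by blast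
    moreover have "finite (\<Union>\<K>)" using \<K> by blast
    ultimately show False by simp
  qed
  then obtain q where q: "q \<in> topspace Y" "\<And>U. openin Y U \<Longrightarrow> q \<in> U \<Longrightarrow> infinite {n. d n \<in> U}"
    by blast
  have "inf (filtercomap d (nhdsin Y q)) sequentially \<noteq> bot"
  proof
    assume "inf (filtercomap d (nhdsin Y q)) sequentially = bot"
    then have "\<forall>\<^sub>F n in inf (filtercomap d (nhdsin Y q)) sequentially. False" by simp
    then obtain P Q where PQ: "eventually P (filtercomap d (nhdsin Y q))" "eventually Q sequentially"
      "\<And>n. \<not> (P n \<and> Q n)"
      by (auto simp: eventually_inf)
    then obtain U where U: "openin Y U" "q \<in> U" "\<And>n. d n \<in> U \<Longrightarrow> P n"
      using q(1) by (auto simp: eventually_filtercomap eventually_nhdsin)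
    obtain N where "\<And>n. n \<ge> N \<Longrightarrow> Q n"
      using PQ(2) by (auto simp: eventually_sequentially)
    then have "n < N" if "d n \<in> U" for n
      using U(3)[OF that] PQ(3)[of n] not_le by blast
    then have "{n. d n \<in> U} \<subseteq> {..<N}" by blast
    then show False using q(2)[OF U(1,2)] finite_subset by blast
  qed
  then obtain u where u: "ultrafilter u" "u \<le> filtercomap d (nhdsin Y q)" "u \<le> sequentially"
    using ultrafilter_exists by (metis le_inf_iff)
  have "limitin Y d q u"
    unfolding limitin_def
  proof (intro conjI allI impI q(1))
    fix U assume "openin Y U \<and> q \<in> U"
    then have "\<forall>\<^sub>F y in nhdsin Y q. y \<in> U"
      using q(1) by (auto simp: eventually_nhdsin)
    then have "\<forall>\<^sub>F n in filtercomap d (nhdsin Y q). d n \<in> U"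
      by (rule eventually_filtercomapI)
    then show "\<forall>\<^sub>F n in u. d n \<in> U" using u(2) by (rule filter_leD[rotated])
  qed
  with u show ?thesis by blast
qed

text \<open>Halve repeatedly: a set lying in infinitely many members of \<open>S\<close> splits so
  that one half still does and the other half lies in at least one member. The discarded halves are
  disjoint and provide \<open>A\<close>.\<close>

lemma infinite_ultrafilters_separated_sequence:
  fixes S :: "'a filter set"
  assumes S: "infinite S" "\<And>F. F \<in> S \<Longrightarrow> ultrafilter F"
  shows "\<exists>A x. separates A x \<and> range (x :: nat \<Rightarrow> 'a filter) \<subseteq> S"
proof -
  define big where "big B \<longleftrightarrow> infinite {F \<in> S. \<forall>\<^sub>F k in F. k \<in> B}" for B
  have step: "\<exists>B'. big B' \<and> B' \<subseteq> B \<and> (\<exists>F\<in>S. \<forall>\<^sub>F k in F. k \<in> B - B')" if B: "big B" for B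
  proof -
    obtain F where F: "F \<in> S" "\<forall>\<^sub>F k in F. k \<in> B"
      using infinite_imp_nonempty[OF B[unfolded big_def]] by blast
    have "infinite ({F \<in> S. \<forall>\<^sub>F k in F. k \<in> B} - {F})" using B by (simp add: big_def)
    then obtain G where G: "G \<in> S" "\<forall>\<^sub>F k in G. k \<in> B" "G \<noteq> F"
      using infinite_imp_nonempty by blast
    obtain P where P: "eventually P F" "\<forall>\<^sub>F k in G. \<not> P k"
      using ultrafilters_distinguished[OF S(2)[OF F(1)] S(2)[OF G(1)]] G(3) by blast
    have "{H \<in> S. \<forall>\<^sub>F k in H. k \<in> B} \<subseteq>
      {H \<in> S. \<forall>\<^sub>F k in H. k \<in> B \<inter> {k. P k}} \<union> {H \<in> S. \<forall>\<^sub>F k in H. k \<in> B \<inter> {k. \<not> P k}}"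
      using S(2) by (auto simp: eventually_conj_iff ultrafilter_not)
    then have "big (B \<inter> {k. P k}) \<or> big (B \<inter> {k. \<not> P k})"
      using B unfolding big_def by (meson finite_UnI finite_subset)
    then show ?thesis
    proof
      assume "big (B \<inter> {k. P k})"
      moreover have "\<forall>\<^sub>F k in G. k \<in> B - B \<inter> {k. P k}"
        using G(2) P(2) by eventually_elim simp
      ultimately show ?thesis using G(1) by blast
    next
      assume "big (B \<inter> {k. \<not> P k})"
      moreover have "\<forall>\<^sub>F k in F. k \<in> B - B \<inter> {k. \<not> P k}"
        using F(2) P(1) by eventually_elim simp
      ultimately show ?thesis using F(1) by blast
    qed
  qed
  have "big UNIV" using S by (simp add: big_def)
  then obtain B where B: "\<And>n::nat. big (B n)"
    "\<And>n. B (Suc n) \<subseteq> B n \<and> (\<exists>F\<in>S. \<forall>\<^sub>F k in F. k \<in> B n - B (Suc n))"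
    using dependent_nat_choice[of "\<lambda>_. big" "\<lambda>_ B B'. B' \<subseteq> B \<and> (\<exists>F\<in>S. \<forall>\<^sub>F k in F. k \<in> B - B')"] step
    by metis
  then obtain x where x: "\<And>n. x n \<in> S" "\<And>n. \<forall>\<^sub>F k in x n. k \<in> B n - B (Suc n)"
    by metis
  have dec: "B n \<subseteq> B m" if "m \<le> n" for m n
    using lift_Suc_antimono_le[of B m n] B(2) that by blast
  have disj: "(B m - B (Suc m)) \<inter> (B n - B (Suc n)) = {}" if "m < n" for m n
    using dec[of "Suc m" n] that by auto
  have "disjoint_family (\<lambda>n. B n - B (Suc n))"
    unfolding disjoint_family_on_def using disj by (metis inf_commute linorder_neqE_nat)
  then have sep: "separates (\<lambda>n. B n - B (Suc n)) x"
    using x S(2) by (simp add: separates_def)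
  with sep x(1) show ?thesis by blast
qed

section \<open>Translation between the subspace topology and ultrafilter limits\<close>

lemma subtopology_omega_star:
  assumes "S \<subseteq> topspace omega_star"
  shows "subtopology omega_star S = subtopology beta_omega S"
  using assms by (simp add: omega_star_def subtopology_subtopology inf.absorb2)

lemma openin_beta_basic_subtopology: "openin (subtopology beta_omega S) (S \<inter> beta_basic A)"
  using openin_beta_basic by (auto simp: openin_subtopology)

text \<open>Isolating open sets give sets \<open>C n\<close> that belong to \<open>x n\<close> and
  to no other term. Removing the finitely many earlier \<open>C m\<close> from \<open>C n\<close>
  makes them disjoint and keeps them in \<open>x n\<close>.\<close>

lemma discrete_imp_separates:
  assumes x: "\<And>n. x n \<in> S" "\<And>F. F \<in> S \<Longrightarrow> ultrafilter F"
    and U: "\<And>n::nat. openin (subtopology beta_omega S) (U n)" "\<And>m n. x m \<in> U n \<longleftrightarrow> m = n"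
  shows "\<exists>A. separates A x"
proof -
  have "\<exists>C. (\<forall>\<^sub>F k in x n. k \<in> C) \<and> (\<forall>m. m \<noteq> n \<longrightarrow> (\<forall>\<^sub>F k in x m. k \<notin> C))" for n
  proof -
    obtain W where W: "openin beta_omega W" "U n = W \<inter> S"
      using U(1)[of n] by (auto simp: openin_subtopology)
    then have "x n \<in> W" using U(2)[of n n] by blast
    then obtain C where C: "x n \<in> beta_basic C" "beta_basic C \<subseteq> W"
      using W(1) by (auto simp: openin_beta_omega_iff)
    have "\<forall>\<^sub>F k in x m. k \<notin> C" if "m \<noteq> n" for m
    proof -
      have "x m \<notin> W" using U(2)[of m n] W(2) x(1)[of m] that by blast
      then have "x m \<notin> beta_basic C" using C(2) by blast
      then show ?thesis using x by (simp add: beta_basic_def ultrafilter_not)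
    qed
    with C(1) show ?thesis by (auto simp: beta_basic_def)
  qed
  then obtain C where C: "\<And>n. \<forall>\<^sub>F k in x n. k \<in> C n" "\<And>m n. m \<noteq> n \<Longrightarrow> \<forall>\<^sub>F k in x m. k \<notin> C n"
    by metis
  have "\<forall>\<^sub>F k in x n. k \<in> disjointed C n" for n
  proof -
    have "\<forall>\<^sub>F k in x n. \<forall>m\<in>{0..<n}. k \<notin> C m"
      using C(2) by (intro eventually_ball_finite) auto
    with C(1)[of n] show ?thesis
      by eventually_elim (auto simp: disjointed_def)
  qed
  then have "separates (disjointed C) x"
    using x disjoint_family_disjointed[of C] by (auto simp: separates_def)
  then show ?thesis by blast
qed

lemma limitin_imp_ultralimit:
  assumes u: "ultrafilter u" and S: "\<And>F. F \<in> S \<Longrightarrow> ultrafilter F" "\<And>n. x n \<in> S"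
    and lim: "limitin (subtopology beta_omega S) x p u"
  shows "ultralimit u x p"
proof -
  have p: "p \<in> S" using lim by (simp add: limitin_def)
  have imp: "\<forall>\<^sub>F n in u. eventually P (x n)" if "eventually P p" for P
  proof -
    have "p \<in> S \<inter> beta_basic {k. P k}" using p that S by (simp add: beta_basic_def)
    then have "\<forall>\<^sub>F n in u. x n \<in> S \<inter> beta_basic {k. P k}"
      using lim openin_beta_basic_subtopology unfolding limitin_def by blast
    then show ?thesis by (auto simp: beta_basic_def elim: eventually_mono)
  qed
  have "eventually P p" if "\<forall>\<^sub>F n in u. eventually P (x n)" for P
  proof (rule ccontr)
    assume "\<not> eventually P p"
    then have "\<forall>\<^sub>F n in u. \<forall>\<^sub>F k in x n. \<not> P k"
      using imp[of "\<lambda>k. \<not> P k"] ultrafilter_not[OF S(1)[OF p]] by blast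
    then have "\<forall>\<^sub>F n in u. \<not> eventually P (x n)"
      using ultrafilter_not[OF S(1)[OF S(2)]] by simp
    then show False using that ultrafilter_not[OF u] by blast
  qed
  with imp show ?thesis by (auto simp: ultralimit_def)
qed

theorem theorem5p14:
  fixes Y :: "'a topology"
  assumes "infinite (topspace Y)"
    and "countably_compact_space Y"
  shows "\<not> arrows_1_2 omega_star Y"
proof
  assume arrows: "arrows_1_2 omega_star Y"
  have copy: "\<exists>i\<in>{0,1}. \<exists>S h. S \<subseteq> P i \<and> S \<subseteq> topspace omega_star \<and>
      homeomorphic_map Y (subtopology beta_omega S) h"
    if P: "topspace omega_star = P 0 \<union> P 1" for P :: "nat \<Rightarrow> nat filter set"
  proof -
    obtain i S where S: "i \<in> {0,1}" "S \<subseteq> P i" "subtopology omega_star S homeomorphic_space Y"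
      using arrows[unfolded arrows_1_2_def, rule_format, OF P] by blast
    then have "S \<subseteq> topspace omega_star" using P by auto
    moreover obtain h where "homeomorphic_map Y (subtopology omega_star S) h"
      using S(3) by (meson homeomorphic_space homeomorphic_space_sym)
    ultimately show ?thesis using S subtopology_omega_star[of S] by auto
  qed
  have ult: "ultrafilter F" if "F \<in> S" "S \<subseteq> topspace omega_star" for F S
    using that by (auto simp: topspace_omega_star)
  have top: "topspace (subtopology beta_omega S) = S" if "S \<subseteq> topspace omega_star" for S
    using that by (auto simp: topspace_omega_star topspace_beta_omega)

  \<comment> \<open>With both parts equal to the whole space, the relation yields some copy of
    \<open>Y\<close>. It serves to find a sequence \<open>d\<close> in \<open>Y\<close> with
    isolating open sets \<open>U n\<close>.\<close>
  obtain S0 h0 where S0: "S0 \<subseteq> topspace omega_star"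
    and h0: "homeomorphic_map Y (subtopology beta_omega S0) h0"
    using copy[of "\<lambda>_. topspace omega_star"] by auto
  have im0: "h0 ` topspace Y = S0" and inj0: "inj_on h0 (topspace Y)"
    using h0 top[OF S0] by (auto simp: homeomorphic_eq_everything_map)
  have "infinite S0" using assms(1) im0 inj0 finite_imageD by blast
  then have "\<exists>A x. separates A x \<and> range (x :: nat \<Rightarrow> nat filter) \<subseteq> S0"
    by (rule infinite_ultrafilters_separated_sequence) (rule ult[OF _ S0])
  then obtain A0 and x0 :: "nat \<Rightarrow> nat filter" where x0: "separates A0 x0" "range x0 \<subseteq> S0"
    by (elim exE conjE)
  have "x0 n \<in> h0 ` topspace Y" for n
    unfolding im0 using x0(2) by (rule subsetD) simp
  then have "\<exists>y. y \<in> topspace Y \<and> h0 y = x0 n" for n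
    by (metis imageE)
  then obtain d where d: "\<And>n::nat. d n \<in> topspace Y" "\<And>n. h0 (d n) = x0 n" by metis
  define U where "U n = {y \<in> topspace Y. h0 y \<in> S0 \<inter> beta_basic (A0 n)}" for n
  have U: "openin Y (U n)" for n
    using homeomorphic_imp_continuous_map[OF h0] openin_beta_basic_subtopology
    unfolding U_def by (rule openin_continuous_map_preimage)
  have dU: "d m \<in> U n \<longleftrightarrow> m = n" for m n
  proof
    assume "d m \<in> U n"
    then have "\<forall>\<^sub>F k in x0 m. k \<in> A0 n" by (simp add: U_def d beta_basic_def)
    then show "m = n"
      using ultrafilter_contradiction[OF separatesD(1,2)[OF x0(1)]] separatesD(3)[OF x0(1)] by metis
  next
    assume "m = n"
    then show "d m \<in> U n"
      using d x0 separatesD(1,2)[OF x0(1), of n] by (auto simp: U_def beta_basic_def)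
  qed

  \<comment> \<open>\<open>u\<close> depends only on \<open>Y\<close> and \<open>d\<close>, so
    \<open>c\<close> is fixed before the monochromatic copy is chosen.\<close>
  obtain u q where u: "ultrafilter u" "u \<le> sequentially" and q: "limitin Y d q u"
    using countably_compact_space_ultralimit[of Y d, OF assms(2) d(1)] by blast
  obtain c :: "nat filter \<Rightarrow> bool" where
    c: "\<And>A x p. separates A x \<Longrightarrow> ultrafilter p \<Longrightarrow> ultralimit u x p \<Longrightarrow> \<forall>\<^sub>F n in u. c (x n) \<noteq> c p"
    using ultralimit_colouring[OF u] by blast

  define P where "P i = {F \<in> topspace omega_star. c F = (i = (0::nat))}" for i
  have "topspace omega_star = P 0 \<union> P 1" by (auto simp: P_def)
  from copy[OF this] obtain i S h where S: "S \<subseteq> P i" "S \<subseteq> topspace omega_star"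
    and h: "homeomorphic_map Y (subtopology beta_omega S) h"
    by (elim bexE exE conjE)
  have im: "h ` topspace Y = S" and inj: "inj_on h (topspace Y)"
    using h top[OF S(2)] by (auto simp: homeomorphic_eq_everything_map)
  have hd: "h (d n) \<in> S" for n using im d(1)[of n] by (metis imageI)
  \<comment> \<open>\<open>h\<close> carries \<open>d\<close>, the sets \<open>U n\<close> and the
    limit \<open>q\<close> into the monochromatic copy, where \<open>c\<close> would have to
    alternate.\<close>
  have "\<exists>A. separates A (h \<circ> d)"
  proof (rule discrete_imp_separates[where S = S and U = "\<lambda>n. h ` U n"])
    show "openin (subtopology beta_omega S) (h ` U n)" for n
      using homeomorphic_map_openness_eq[OF h] U by blast
    show "(h \<circ> d) m \<in> h ` U n \<longleftrightarrow> m = n" for m n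
      using inj_on_image_mem_iff[OF inj d(1)[of m], of "U n"] dU by (auto simp: U_def)
  qed (use hd ult[OF _ S(2)] in auto)
  then obtain A where A: "separates A (h \<circ> d)" ..
  have lim: "limitin (subtopology beta_omega S) (h \<circ> d) (h q) u"
    using continuous_map_limit[OF homeomorphic_imp_continuous_map[OF h] q] .
  then have hq: "h q \<in> S" by (simp add: limitin_def)
  have "ultralimit u (h \<circ> d) (h q)"
    using limitin_imp_ultralimit[OF u(1) ult[OF _ S(2)] _ lim] hd by simp
  then have "\<forall>\<^sub>F n in u. c ((h \<circ> d) n) \<noteq> c (h q)"
    using c[OF A] ult[OF hq S(2)] by blast
  moreover have "c ((h \<circ> d) n) = c (h q)" for n
    using subsetD[OF S(1) hd] subsetD[OF S(1) hq] by (simp add: P_def)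
  ultimately show False using u(1) by (simp add: ultrafilter_def)
qed

end
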